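(* Let $n$ be a positive integer. (a) If $G$ is the dihedral group $D_{2n}$, then $\Gamma_{CCC}(G)$ is always a cograph and a chordal graph. Moreover, it is a split graph as well as a threshold graph when $n\not\equiv 2\pmod 4$. (b) If $G$ is the dicyclic group $T_{4n}$, then $\Gamma_{CCC}(G)$ is always a cograph and a chordal graph. Moreover, it is a split graph as well as a threshold graph when $n$ is even.
   Context: $D_{2n}=\langle x,y\mid x^n=y^2=1,\ yxy^{-1}=x^{-1}\rangle$ is the dihedral group of order $2n$, and $T_{4n}=\langle x,y\mid x^{2n}=1,\ x^n=y^2,\ y^{-1}xy=x^{-1}\rangle$ is the dicyclic group of order $4n$. For a finite group $G$, the commuting conjugacy class graph $\Gamma_{CCC}(G)$ is the simple graph whose vertices are the non-central conjugacy classes of $G$ (the classes $x^G$ with $x\notin Z(G)$), two distinct vertices $x^G$ and $y^G$ being adjacent if and only if there exist $a\in x^G$ and $b\in y^G$ such that $\langle a,b\rangle$ is abelian. In terms of forbidden induced subgraphs: a graph is a cograph if it has no induced $P_4$ (path on four vertices); chordal if it has no induced cycle $C_m$ with $m\ge4$; split if it has no induced $C_4$, $C_5$ or $2K_2$; threshold if it has no induced $2K_2$, $C_4$ or $P_4$. *)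

theory Defs
  imports
    "HOL-Algebra.Elementary_Groups"
    "HOL-Number_Theory.Cong"
    "Graph_Theory.Pair_Digraph"
    "Graph_Theory.Digraph_Isomorphism"
begin

section \<open>Groups given by generators and relations\<close>

text \<open>
  A word is a list of letters; \<open>(g, True)\<close> stands for the generator \<open>g\<close> and
  \<open>(g, False)\<close> for its formal inverse.
\<close>

type_synonym 'g word = "('g \<times> bool) list"

definition word_gen :: "'g \<Rightarrow> 'g word" where
  "word_gen g = [(g, True)]"

definition word_inv_gen :: "'g \<Rightarrow> 'g word" where
  "word_inv_gen g = [(g, False)]"

definition word_pow :: "'g word \<Rightarrow> nat \<Rightarrow> 'g word" where
  "word_pow w n = concat (replicate n w)"

text \<open>
  The least congruence on words that cancels adjacent mutually inverse letters and contains
  \<open>R\<close>, where \<open>(u, v) \<in> R\<close> stands for the defining relation \<open>u = v\<close>. The quotient of the free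
  monoid of words by it is the group \<open>\<langle>'g | R\<rangle>\<close>: the free group on the elements of the
  type \<open>'g\<close> modulo the normal closure of all \<open>u v\<inverse>\<close>.
\<close>

inductive word_eq :: "('g word \<times> 'g word) set \<Rightarrow> 'g word \<Rightarrow> 'g word \<Rightarrow> bool"
  for R :: "('g word \<times> 'g word) set" where
  refl: "word_eq R u u"
| sym: "word_eq R u v \<Longrightarrow> word_eq R v u"
| trans: "word_eq R u v \<Longrightarrow> word_eq R v w \<Longrightarrow> word_eq R u w"
| append: "word_eq R u u' \<Longrightarrow> word_eq R v v' \<Longrightarrow> word_eq R (u @ v) (u' @ v')"
| cancel: "word_eq R [(g, b), (g, \<not> b)] []"
| rel: "(u, v) \<in> R \<Longrightarrow> word_eq R u v"

definition word_class :: "('g word \<times> 'g word) set \<Rightarrow> 'g word \<Rightarrow> 'g word set" where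
  "word_class R u = {v. word_eq R u v}"

definition presented_group :: "('g word \<times> 'g word) set \<Rightarrow> 'g word set monoid" where
  "presented_group R =
    \<lparr>carrier = range (word_class R),
     monoid.mult = (\<lambda>A B. \<Union>u\<in>A. \<Union>v\<in>B. word_class R (u @ v)),
     monoid.one = word_class R []\<rparr>"

lemma word_class_eq_iff: "word_class R u = word_class R v \<longleftrightarrow> word_eq R u v"
  unfolding word_class_def by (auto intro: word_eq.intros)

lemma presented_group_mult:
  "word_class R u \<otimes>\<^bsub>presented_group R\<^esub> word_class R v = word_class R (u @ v)"
  unfolding presented_group_def word_class_def
  by (auto intro: word_eq.refl word_eq.trans word_eq.append)

lemma word_left_inverse: "\<exists>v. word_eq R (v @ u) []"
proof (induction u)
  case Nil
  show ?case by (metis append_Nil word_eq.refl)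
next
  case (Cons a u)
  then obtain v where v: "word_eq R (v @ u) []" by blast
  obtain g b where a: "a = (g, b)" by (cases a)
  have "word_eq R ([(g, \<not> b), (g, b)] @ u) ([] @ u)"
    using word_eq.append[OF word_eq.cancel[of R g "\<not> b"] word_eq.refl] by simp
  then have "word_eq R (v @ ([(g, \<not> b), (g, b)] @ u)) (v @ ([] @ u))"
    by (rule word_eq.append[OF word_eq.refl])
  then have "word_eq R ((v @ [(g, \<not> b)]) @ a # u) []"
    using v a word_eq.trans by fastforce
  then show ?case by blast
qed

lemma group_presented_group: "group (presented_group R)"
proof (rule groupI)
  fix x assume "x \<in> carrier (presented_group R)"
  then obtain u where u: "x = word_class R u" by (auto simp: presented_group_def)
  obtain v where "word_eq R (v @ u) []" using word_left_inverse by blast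
  then have "word_class R v \<otimes>\<^bsub>presented_group R\<^esub> x = \<one>\<^bsub>presented_group R\<^esub>"
    unfolding u presented_group_mult by (simp add: presented_group_def word_class_eq_iff)
  then show "\<exists>y\<in>carrier (presented_group R). y \<otimes>\<^bsub>presented_group R\<^esub> x = \<one>\<^bsub>presented_group R\<^esub>"
    by (auto simp: presented_group_def)
next
  fix x assume "x \<in> carrier (presented_group R)"
  then obtain u where u: "x = word_class R u" by (auto simp: presented_group_def)
  have "\<one>\<^bsub>presented_group R\<^esub> = word_class R []" by (simp add: presented_group_def)
  then show "\<one>\<^bsub>presented_group R\<^esub> \<otimes>\<^bsub>presented_group R\<^esub> x = x"
    by (simp add: u presented_group_mult)
next
  fix x y assume "x \<in> carrier (presented_group R)" "y \<in> carrier (presented_group R)"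
  then obtain u v where "x = word_class R u" "y = word_class R v"
    by (auto simp: presented_group_def)
  then show "x \<otimes>\<^bsub>presented_group R\<^esub> y \<in> carrier (presented_group R)"
    using presented_group_mult[of R u v] by (simp add: presented_group_def)
next
  fix x y z
  assume "x \<in> carrier (presented_group R)" "y \<in> carrier (presented_group R)"
    "z \<in> carrier (presented_group R)"
  then obtain u v w where "x = word_class R u" "y = word_class R v" "z = word_class R w"
    by (auto simp: presented_group_def)
  then show "x \<otimes>\<^bsub>presented_group R\<^esub> y \<otimes>\<^bsub>presented_group R\<^esub> z =
    x \<otimes>\<^bsub>presented_group R\<^esub> (y \<otimes>\<^bsub>presented_group R\<^esub> z)"
    by (simp add: presented_group_mult)
qed (simp add: presented_group_def)

datatype xy = X | Y

text \<open>\<open>D\<^bsub>2n\<^esub> = \<langle>x, y | x\<^sup>n = y\<^sup>2 = 1, y x y\<inverse> = x\<inverse>\<rangle>\<close>; the argument is \<open>n\<close>, not the order.\<close>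

definition dihedral_group :: "nat \<Rightarrow> xy word set monoid" where
  "dihedral_group n = presented_group
    {(word_pow (word_gen X) n, []),
     (word_pow (word_gen Y) 2, []),
     (word_gen Y @ word_gen X @ word_inv_gen Y, word_inv_gen X)}"

text \<open>\<open>T\<^bsub>4n\<^esub> = \<langle>x, y | x\<^bsup>2n\<^esup> = 1, x\<^sup>n = y\<^sup>2, y\<inverse> x y = x\<inverse>\<rangle>\<close>; the argument is \<open>n\<close>, not the order.\<close>

definition dicyclic_group :: "nat \<Rightarrow> xy word set monoid" where
  "dicyclic_group n = presented_group
    {(word_pow (word_gen X) (2 * n), []),
     (word_pow (word_gen X) n, word_pow (word_gen Y) 2),
     (word_inv_gen Y @ word_gen X @ word_gen Y, word_inv_gen X)}"


section \<open>The commuting conjugacy class graph\<close>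

text \<open>
  Simple graphs are loop-free symmetric digraphs without parallel arcs: each edge is a pair of
  opposite arcs (locale \<^locale>\<open>pair_bidirected_digraph\<close>).
\<close>

definition group_center :: "('a, 'b) monoid_scheme \<Rightarrow> 'a set" where
  "group_center G = {z \<in> carrier G. \<forall>g\<in>carrier G. z \<otimes>\<^bsub>G\<^esub> g = g \<otimes>\<^bsub>G\<^esub> z}"

definition conj_class :: "('a, 'b) monoid_scheme \<Rightarrow> 'a \<Rightarrow> 'a set" where
  "conj_class G x = {g \<otimes>\<^bsub>G\<^esub> x \<otimes>\<^bsub>G\<^esub> inv\<^bsub>G\<^esub> g | g. g \<in> carrier G}"

definition noncentral_classes :: "('a, 'b) monoid_scheme \<Rightarrow> 'a set set" where
  "noncentral_classes G = conj_class G ` (carrier G - group_center G)"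

definition ccc_graph :: "('a, 'b) monoid_scheme \<Rightarrow> 'a set pair_pre_digraph" where
  "ccc_graph G =
    \<lparr>pverts = noncentral_classes G,
     parcs = {(A, B). A \<in> noncentral_classes G \<and> B \<in> noncentral_classes G \<and> A \<noteq> B \<and>
       (\<exists>a\<in>A. \<exists>b\<in>B. comm_group (subgroup_generated G {a, b}))}\<rparr>"

lemma ccc_graph_simple: "pair_bidirected_digraph (ccc_graph G)"
proof -
  have wf: "pair_wf_digraph (ccc_graph G)"
    by unfold_locales (auto simp: ccc_graph_def)
  moreover have "symmetric (ccc_graph G)"
    unfolding symmetric_def by (rule symI) (fastforce simp: ccc_graph_def insert_commute)
  moreover have "\<And>e. e \<in> parcs (ccc_graph G) \<Longrightarrow> fst e \<noteq> snd e"
    by (auto simp: ccc_graph_def)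
  ultimately show ?thesis
    by (simp add: pair_bidirected_digraph_def pair_sym_digraph_def pair_loopfree_digraph_def
        pair_sym_digraph_axioms_def pair_loopfree_digraph_axioms_def)
qed


section \<open>Forbidden induced subgraphs\<close>

definition path_graph :: "nat \<Rightarrow> nat pair_pre_digraph" where
  "path_graph m =
    \<lparr>pverts = {..<m},
     parcs = {(i, j). i < m \<and> j < m \<and> (j = i + 1 \<or> i = j + 1)}\<rparr>"

text \<open>A simple graph, and then the usual cycle \<open>C\<^sub>m\<close>, only for \<open>m \<ge> 3\<close>.\<close>

definition cycle_graph :: "nat \<Rightarrow> nat pair_pre_digraph" where
  "cycle_graph m =
    \<lparr>pverts = {..<m},
     parcs = {(i, j). i < m \<and> j < m \<and> (j = (i + 1) mod m \<or> i = (j + 1) mod m)}\<rparr>"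

definition two_K2 :: "nat pair_pre_digraph" where
  "two_K2 = \<lparr>pverts = {0, 1, 2, 3}, parcs = {(0, 1), (1, 0), (2, 3), (3, 2)}\<rparr>"

definition has_induced :: "'h pair_pre_digraph \<Rightarrow> 'a pair_pre_digraph \<Rightarrow> bool" where
  "has_induced H \<Gamma> \<longleftrightarrow>
    (\<exists>K. induced_subgraph K (with_proj \<Gamma>) \<and> digraph_iso (with_proj H) K)"

definition cograph :: "'a pair_pre_digraph \<Rightarrow> bool" where
  "cograph \<Gamma> \<longleftrightarrow> \<not> has_induced (path_graph 4) \<Gamma>"

definition chordal_graph :: "'a pair_pre_digraph \<Rightarrow> bool" where
  "chordal_graph \<Gamma> \<longleftrightarrow> (\<forall>m\<ge>4. \<not> has_induced (cycle_graph m) \<Gamma>)"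

definition split_graph :: "'a pair_pre_digraph \<Rightarrow> bool" where
  "split_graph \<Gamma> \<longleftrightarrow>
    \<not> has_induced (cycle_graph 4) \<Gamma> \<and> \<not> has_induced (cycle_graph 5) \<Gamma> \<and> \<not> has_induced two_K2 \<Gamma>"

definition threshold_graph :: "'a pair_pre_digraph \<Rightarrow> bool" where
  "threshold_graph \<Gamma> \<longleftrightarrow>
    \<not> has_induced two_K2 \<Gamma> \<and> \<not> has_induced (cycle_graph 4) \<Gamma> \<and> \<not> has_induced (path_graph 4) \<Gamma>"

end

theory Submission
  imports Defs "HOL-Algebra.Multiplicative_Group"
begin

text \<open>
  Both families consist of groups generated by two elements \<open>x\<close> and \<open>y\<close> such that \<open>y\<close> inverts
  \<open>x\<close> and \<open>y\<^sup>2\<close> is a power of \<open>x\<close> (locale \<open>inverting_pair\<close>). Every element of such a group is a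
  rotation \<open>x\<^sup>i\<close> or a reflection \<open>x\<^sup>i y\<close>. The non-central classes of rotations are pairwise
  adjacent, because rotations commute. Conjugation by \<open>x\<close> turns \<open>x\<^sup>i y\<close> into \<open>x\<^bsup>i+2\<^esup> y\<close>, so
  the reflections lie in at most two classes, those of \<open>y\<close> and \<open>x y\<close>. A rotation that
  commutes with a reflection equals its own inverse and is therefore central, so no edge joins a
  class of rotations to a class of reflections. Hence every component of the commuting conjugacy
  class graph is complete (\<open>ccc_graph_cluster\<close>): a path on three vertices is never induced, and
  \<open>P\<^sub>4\<close> and all cycles \<open>C\<^sub>m\<close> with \<open>m \<ge> 4\<close> contain such a path as an induced subgraph.

  An induced \<open>2K\<^sub>2\<close> can then only arise when the two classes of reflections are distinct
  and adjacent. If \<open>x\<^sup>i y\<close> commutes with \<open>x\<^sup>j y\<close>, then \<open>x\<^bsup>2(i-j)\<^esup> = 1\<close>, where \<open>i - j\<close> is odd for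
  reflections in different classes; this is impossible when \<open>4\<close> divides the order of \<open>x\<close>. When
  the order of \<open>x\<close> is odd, the two classes coincide. So \<open>2K\<^sub>2\<close> is excluded unless the order of
  \<open>x\<close> is \<open>2\<close> modulo \<open>4\<close> (\<open>ccc_graph_no_two_K2\<close>).

  What remains is that \<open>x\<close> has order exactly \<open>n\<close> in \<open>D\<^bsub>2n\<^esub>\<close> and \<open>2n\<close> in \<open>T\<^bsub>4n\<^esub>\<close>. The relations
  bound the order from above; that they do not collapse it further is seen by letting words act
  on normal forms \<open>x\<^sup>k y\<^sup>e\<close>, with \<open>k\<close> read modulo the expected order
  (\<open>word_act_respects_word_eq\<close>).
\<close>

section \<open>Induced subgraphs of cluster graphs\<close>

text \<open>
  Induced copies are subgraphs together with a digraph isomorphism, which acts on vertices and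
  arcs separately. Since an arc is the pair of its ends, the action on vertices carries all the
  information.
\<close>

lemma has_induced_embedding:
  assumes "has_induced H \<Gamma>"
  obtains f where "inj_on f (pverts H)"
    and "\<And>u v. u \<in> pverts H \<Longrightarrow> v \<in> pverts H \<Longrightarrow>
           (f u, f v) \<in> parcs \<Gamma> \<longleftrightarrow> (u, v) \<in> parcs H"
proof -
  from assms obtain h where
    ind: "induced_subgraph (app_iso h (with_proj H)) (with_proj \<Gamma>)" and
    iso: "pre_digraph.digraph_isomorphism (with_proj H) h"
    unfolding has_induced_def digraph_iso_def by blast
  define f where "f = iso_verts h"
  have wf: "wf_digraph (with_proj H)" and inj: "inj_on f (pverts H)"
    using iso by (auto simp: pre_digraph.digraph_isomorphism_def f_def)
  have ends: "iso_tail h = fst" "iso_head h = snd"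
    using ind by (auto simp: induced_subgraph_def subgraph_def compatible_def)
  have img: "iso_arcs h e = (f (fst e), f (snd e))" if "e \<in> parcs H" for e
    using iso that ends by (auto simp: pre_digraph.digraph_isomorphism_def f_def prod_eq_iff)
  have arcs: "iso_arcs h ` parcs H
      = {e \<in> parcs \<Gamma>. fst e \<in> f ` pverts H \<and> snd e \<in> f ` pverts H}"
    using ind by (simp add: induced_subgraph_def f_def)
  have "(f u, f v) \<in> parcs \<Gamma> \<longleftrightarrow> (u, v) \<in> parcs H"
    if u: "u \<in> pverts H" and v: "v \<in> pverts H" for u v
  proof
    assume "(f u, f v) \<in> parcs \<Gamma>"
    then have "(f u, f v) \<in> iso_arcs h ` parcs H" using arcs u v by auto
    then obtain e where e: "e \<in> parcs H" "f (fst e) = f u" "f (snd e) = f v"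
      using img by auto
    moreover have "fst e \<in> pverts H" "snd e \<in> pverts H"
      using wf_digraph.wellformed[OF wf] e(1) by auto
    ultimately have "e = (u, v)" using inj u v by (metis inj_onD prod.collapse)
    with e show "(u, v) \<in> parcs H" by simp
  next
    assume uv: "(u, v) \<in> parcs H"
    then have "iso_arcs h (u, v) \<in> parcs \<Gamma>" using arcs by blast
    with img[OF uv] show "(f u, f v) \<in> parcs \<Gamma>" by simp
  qed
  with inj that show thesis by blast
qed

text \<open>
  A simple graph is a disjoint union of complete graphs exactly if adjacency is transitive up to
  equality of the end vertices.
\<close>

definition cluster_graph :: "'a pair_pre_digraph \<Rightarrow> bool" where
  "cluster_graph \<Gamma> \<longleftrightarrow>
    (\<forall>A B C. (A, B) \<in> parcs \<Gamma> \<longrightarrow> (B, C) \<in> parcs \<Gamma> \<longrightarrow> A \<noteq> C \<longrightarrow> (A, C) \<in> parcs \<Gamma>)"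

lemma cluster_graph_no_induced_path:
  assumes cluster: "cluster_graph \<Gamma>"
    and verts: "u \<in> pverts H" "v \<in> pverts H" "w \<in> pverts H"
    and path: "(u, v) \<in> parcs H" "(v, w) \<in> parcs H" "u \<noteq> w" "(u, w) \<notin> parcs H"
  shows "\<not> has_induced H \<Gamma>"
proof
  assume "has_induced H \<Gamma>"
  then obtain f where f: "inj_on f (pverts H)"
    "\<And>u v. u \<in> pverts H \<Longrightarrow> v \<in> pverts H \<Longrightarrow> (f u, f v) \<in> parcs \<Gamma> \<longleftrightarrow> (u, v) \<in> parcs H"
    by (rule has_induced_embedding) blast
  have "f u \<noteq> f w" using f(1) verts path by (auto dest: inj_onD)
  then show False using cluster f(2) verts path unfolding cluster_graph_def by meson
qed

lemma cluster_graph_cograph: "cluster_graph \<Gamma> \<Longrightarrow> cograph \<Gamma>"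
  unfolding cograph_def
  by (rule cluster_graph_no_induced_path[where u = 0 and v = 1 and w = 2])
     (auto simp: path_graph_def)

lemma cluster_graph_chordal: "cluster_graph \<Gamma> \<Longrightarrow> chordal_graph \<Gamma>"
  unfolding chordal_graph_def
proof (intro allI impI)
  fix m :: nat
  assume "cluster_graph \<Gamma>" "4 \<le> m"
  then show "\<not> has_induced (cycle_graph m) \<Gamma>"
    by (intro cluster_graph_no_induced_path[where u = 0 and v = 1 and w = 2])
       (auto simp: cycle_graph_def)
qed

text \<open>
  The hypothesis makes the non-isolated vertices a clique, so an end of one edge of an induced
  \<open>2K\<^sub>2\<close> would be adjacent to an end of the other.
\<close>

lemma two_K2_not_induced:
  assumes "\<And>A B C D. (A, B) \<in> parcs \<Gamma> \<Longrightarrow> (C, D) \<in> parcs \<Gamma> \<Longrightarrow> A \<noteq> C \<Longrightarrow> (A, C) \<in> parcs \<Gamma>"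
  shows "\<not> has_induced two_K2 \<Gamma>"
proof
  assume "has_induced two_K2 \<Gamma>"
  then obtain f where f: "inj_on f (pverts two_K2)"
    "\<And>u v. u \<in> pverts two_K2 \<Longrightarrow> v \<in> pverts two_K2 \<Longrightarrow>
      (f u, f v) \<in> parcs \<Gamma> \<longleftrightarrow> (u, v) \<in> parcs two_K2"
    by (rule has_induced_embedding) blast
  have "(f 0, f 1) \<in> parcs \<Gamma>" "(f 2, f 3) \<in> parcs \<Gamma>" "(f 0, f 2) \<notin> parcs \<Gamma>"
    by (subst f(2); simp add: two_K2_def)+
  moreover have "f 0 \<noteq> f 2" using f(1) by (auto simp: two_K2_def inj_on_def)
  ultimately show False using assms by blast
qed

lemma cluster_graph_split_threshold:
  assumes "cluster_graph \<Gamma>" "\<not> has_induced two_K2 \<Gamma>"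
  shows "split_graph \<Gamma> \<and> threshold_graph \<Gamma>"
  using assms cluster_graph_cograph[of \<Gamma>] cluster_graph_chordal[of \<Gamma>]
  by (auto simp: split_graph_def threshold_graph_def cograph_def chordal_graph_def)


section \<open>Conjugacy classes\<close>

context group
begin

lemma conj_class_subset: "c \<in> carrier G \<Longrightarrow> conj_class G c \<subseteq> carrier G"
  by (auto simp: conj_class_def)

lemma conj_class_self: "c \<in> carrier G \<Longrightarrow> c \<in> conj_class G c"
  unfolding conj_class_def by (auto intro!: exI[of _ "\<one>"])

lemma conj_class_trans:
  assumes "c \<in> carrier G" "a \<in> conj_class G c" "b \<in> conj_class G a"
  shows "b \<in> conj_class G c"
proof -
  obtain g h where gh: "g \<in> carrier G" "h \<in> carrier G"
    and a: "a = g \<otimes> c \<otimes> inv g" and b: "b = h \<otimes> a \<otimes> inv h"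
    using assms by (auto simp: conj_class_def)
  have "b = (h \<otimes> g) \<otimes> c \<otimes> inv (h \<otimes> g)"
    using gh assms(1) by (simp add: a b m_assoc inv_mult_group)
  then show ?thesis using gh by (auto simp: conj_class_def)
qed

lemma conj_class_sym:
  assumes "c \<in> carrier G" "a \<in> conj_class G c"
  shows "c \<in> conj_class G a"
proof -
  obtain g where g: "g \<in> carrier G" and a: "a = g \<otimes> c \<otimes> inv g"
    using assms by (auto simp: conj_class_def)
  have "c = inv g \<otimes> a \<otimes> inv (inv g)"
    using g assms(1) by (simp add: a m_assoc inv_solve_left)
  then show ?thesis using g unfolding conj_class_def by blast
qed

lemma conj_class_eq:
  assumes "c \<in> carrier G" "a \<in> conj_class G c"
  shows "conj_class G a = conj_class G c"
  using assms conj_class_trans conj_class_sym conj_class_subset by blast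

lemma conj_class_central:
  assumes "z \<in> group_center G"
  shows "conj_class G z = {z}"
proof -
  have z: "z \<in> carrier G" "\<And>g. g \<in> carrier G \<Longrightarrow> g \<otimes> z = z \<otimes> g"
    using assms by (auto simp: group_center_def)
  have "g \<otimes> z \<otimes> inv g = z" if "g \<in> carrier G" for g
    using z that by (simp add: m_assoc)
  then show ?thesis using conj_class_self[OF z(1)] by (auto simp: conj_class_def)
qed

text \<open>
  The class of a central element is a singleton, so a non-central class has no central member,
  and each of its members represents it.
\<close>

lemma noncentral_classE:
  assumes "A \<in> noncentral_classes G" "a \<in> A"
  shows "a \<in> carrier G" and "a \<notin> group_center G" and "A = conj_class G a"
proof -
  obtain c where c: "c \<in> carrier G" "c \<notin> group_center G" "A = conj_class G c"
    using assms by (auto simp: noncentral_classes_def)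
  then show a: "a \<in> carrier G" "A = conj_class G a"
    using assms(2) conj_class_subset conj_class_eq[OF c(1)] by blast+
  have "c \<in> conj_class G a" using conj_class_self[OF c(1)] a(2) c(3) by simp
  then show "a \<notin> group_center G"
    using conj_class_central[of a] c(2) by auto
qed

lemma noncentral_class_nonempty: "A \<in> noncentral_classes G \<Longrightarrow> \<exists>a. a \<in> A"
  using conj_class_self by (auto simp: noncentral_classes_def)

lemma comm_group_pair_commute:
  assumes "a \<in> carrier G" "b \<in> carrier G" "comm_group (subgroup_generated G {a, b})"
  shows "a \<otimes> b = b \<otimes> a"
proof -
  have "a \<in> carrier (subgroup_generated G {a, b})" "b \<in> carrier (subgroup_generated G {a, b})"
    using assms(1,2) by (auto simp: carrier_subgroup_generated intro: generate.incl)
  from comm_groupE(4)[OF assms(3) this] show ?thesis by simp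
qed

lemma ccc_graph_adjacentE:
  assumes "(A, B) \<in> parcs (ccc_graph G)"
  obtains a b where "A \<in> noncentral_classes G" "B \<in> noncentral_classes G" "A \<noteq> B"
    "a \<in> A" "b \<in> B" "a \<otimes> b = b \<otimes> a"
proof -
  obtain a b where AB: "A \<in> noncentral_classes G" "B \<in> noncentral_classes G" "A \<noteq> B"
    and ab: "a \<in> A" "b \<in> B" "comm_group (subgroup_generated G {a, b})"
    using assms by (auto simp: ccc_graph_def)
  have "a \<otimes> b = b \<otimes> a"
    using noncentral_classE(1)[OF AB(1) ab(1)] noncentral_classE(1)[OF AB(2) ab(2)] ab(3)
    by (rule comm_group_pair_commute)
  with AB ab(1,2) that show thesis by blast
qed

end


section \<open>Groups generated by an element and an inverting element\<close>

text \<open>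
  \<open>D\<^bsub>2n\<^esub>\<close> is an instance with \<open>M = 0\<close>, and \<open>T\<^bsub>4n\<^esub>\<close> with \<open>M = n\<close>. The order of \<open>x\<close> is left open,
  so that both families are treated at once.
\<close>

locale inverting_pair = group G for G (structure) +
  fixes x y :: 'a and M :: int
  assumes x_closed [simp]: "x \<in> carrier G" and y_closed [simp]: "y \<in> carrier G"
    and y_x: "y \<otimes> x = inv x \<otimes> y"
    and y_y: "y \<otimes> y = x [^] M"
    and generated: "carrier G = generate G {x, y}"
begin

definition rotations :: "'a set" where
  "rotations = range (\<lambda>i::int. x [^] i)"

text \<open>
  Conjugation by \<open>y\<close> is an automorphism that inverts \<open>x\<close>, so it inverts all powers of \<open>x\<close>. This
  rule moves \<open>y\<close> to the right in every product.
\<close>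

lemma y_pow: "y \<otimes> x [^] (i::int) = x [^] (- i) \<otimes> y"
proof -
  have nat: "y \<otimes> x [^] k = inv (x [^] k) \<otimes> y" for k :: nat
  proof (induction k)
    case (Suc k)
    have "y \<otimes> x [^] Suc k = (y \<otimes> x [^] k) \<otimes> x"
      by (simp add: m_assoc)
    also have "\<dots> = inv (x [^] k) \<otimes> (y \<otimes> x)"
      unfolding Suc by (simp add: m_assoc)
    also have "\<dots> = inv (x [^] k) \<otimes> inv x \<otimes> y"
      by (simp add: y_x m_assoc)
    also have "inv (x [^] k) \<otimes> inv x = inv (x [^] Suc k)"
      by (metis inv_mult_group nat_pow_Suc2 nat_pow_closed x_closed)
    finally show ?case .
  qed simp
  show ?thesis
  proof (cases "i \<ge> 0")
    case True
    then show ?thesis using nat[of "nat i"]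
      by (metis int_pow_int int_pow_neg nonneg_int_cases nat_int x_closed)
  next
    case False
    define k where "k = nat (- i)"
    have i: "i = - int k" using False by (simp add: k_def)
    have "y \<otimes> inv (x [^] k) = x [^] k \<otimes> (y \<otimes> x [^] k) \<otimes> inv (x [^] k)"
      by (simp add: nat flip: m_assoc)
    then show ?thesis by (simp add: i int_pow_neg int_pow_int m_assoc)
  qed
qed

lemma rotation_rotation: "x [^] (i::int) \<otimes> x [^] (j::int) = x [^] (i + j)"
  by (simp add: int_pow_mult)

lemma rotation_reflection: "x [^] (i::int) \<otimes> (x [^] (j::int) \<otimes> y) = x [^] (i + j) \<otimes> y"
  by (simp add: int_pow_mult flip: m_assoc)

lemma reflection_rotation: "(x [^] (i::int) \<otimes> y) \<otimes> x [^] (j::int) = x [^] (i - j) \<otimes> y"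
  by (simp add: m_assoc y_pow rotation_reflection)

lemma reflection_reflection:
  "(x [^] (i::int) \<otimes> y) \<otimes> (x [^] (j::int) \<otimes> y) = x [^] (i - j + M)"
proof -
  have "(x [^] i \<otimes> y) \<otimes> (x [^] j \<otimes> y) = ((x [^] i \<otimes> y) \<otimes> x [^] j) \<otimes> y"
    by (simp add: m_assoc)
  also have "\<dots> = x [^] (i - j) \<otimes> (y \<otimes> y)"
    by (simp add: reflection_rotation m_assoc)
  finally show ?thesis by (simp add: y_y rotation_rotation)
qed

lemmas normal_form_mult =
  rotation_rotation rotation_reflection reflection_rotation reflection_reflection

lemma inv_rotation: "inv (x [^] (i::int)) = x [^] (- i)"
  by (simp add: int_pow_neg)

lemma inv_reflection: "inv (x [^] (i::int) \<otimes> y) = x [^] (i - M) \<otimes> y"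
  by (rule inv_equality) (simp_all add: normal_form_mult)

lemma normal_form:
  assumes "g \<in> carrier G"
  shows "\<exists>i::int. g = x [^] i \<or> g = x [^] i \<otimes> y"
proof -
  have "g \<in> generate G {x, y}" using assms generated by simp
  then show ?thesis
  proof induction
    case one
    show ?case by (metis int_pow_0)
  next
    case (incl h)
    then show ?case by (metis insertE singletonD int_pow_1 int_pow_0 l_one x_closed y_closed)
  next
    case (inv h)
    then consider "h = x" | "h = y" by blast
    then show ?case
    proof cases
      case 1
      then show ?thesis using inv_rotation[of 1] by (auto intro!: exI[of _ "-1"])
    next
      case 2
      then show ?thesis using inv_reflection[of 0] by (auto intro!: exI[of _ "- M"])
    qed
  next
    case (eng h1 h2)
    then show ?case by (elim exE disjE) (simp add: normal_form_mult; blast)+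
  qed
qed

lemma noncentral_element_cases:
  assumes "A \<in> noncentral_classes G" "a \<in> A"
  obtains (rotation) i :: int where "a = x [^] i"
        | (reflection) i :: int where "a = x [^] i \<otimes> y"
  using normal_form noncentral_classE(1)[OF assms] by blast

text \<open>
  Commuting with one reflection forces \<open>x\<^sup>i = x\<^bsup>-i\<^esup>\<close>, and then \<open>x\<^sup>i\<close> commutes with all
  reflections; with rotations it commutes anyway.
\<close>

lemma rotation_central:
  assumes "x [^] (i::int) \<otimes> (x [^] (j::int) \<otimes> y) = (x [^] j \<otimes> y) \<otimes> x [^] i"
  shows "x [^] i \<in> group_center G"
proof -
  have "x [^] (i + j) = x [^] (j - i)"
    using assms by (simp add: normal_form_mult)
  have "x [^] (k + i) = x [^] (k - i)" for k
  proof -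
    have "x [^] (i + j) \<otimes> x [^] (k - j) = x [^] (j - i) \<otimes> x [^] (k - j)"
      by (simp only: \<open>x [^] (i + j) = x [^] (j - i)\<close>)
    then show ?thesis unfolding rotation_rotation by (simp add: algebra_simps)
  qed
  then show ?thesis
    using normal_form
    by (fastforce simp: group_center_def normal_form_mult add.commute[of i])
qed

lemma conj_rotation:
  assumes "g \<in> carrier G"
  shows "g \<otimes> x [^] (i::int) \<otimes> inv g \<in> rotations"
  using normal_form[OF assms]
  by (auto simp: normal_form_mult inv_rotation inv_reflection rotations_def)

text \<open>
  Conjugating by \<open>x\<^sup>k\<close> shifts the exponent of a reflection by \<open>2k\<close>, so the parity of an exponent
  determines the class.
\<close>

lemma reflection_conj_class: "x [^] (i + 2 * k) \<otimes> y \<in> conj_class G (x [^] (i::int) \<otimes> y)"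
proof -
  have "x [^] (i + 2 * k) \<otimes> y = x [^] k \<otimes> (x [^] i \<otimes> y) \<otimes> inv (x [^] k)"
    by (simp add: normal_form_mult inv_rotation algebra_simps)
  then show ?thesis by (auto simp: conj_class_def)
qed

lemma reflection_conj_class_parity:
  "conj_class G (x [^] i \<otimes> y) = conj_class G (x [^] (i mod 2 :: int) \<otimes> y)"
  using conj_class_eq[OF _ reflection_conj_class[of "i mod 2" "i div 2"]] by simp

lemma rotation_class_subset:
  assumes "A \<in> noncentral_classes G" "a \<in> A" "a \<in> rotations"
  shows "A \<subseteq> rotations"
  using noncentral_classE[OF assms(1,2)] assms(3) conj_rotation
  by (auto simp: conj_class_def rotations_def)

lemma comm_group_rotations:
  assumes "a \<in> rotations" "b \<in> rotations"
  shows "comm_group (subgroup_generated G {a, b})"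
proof (rule group.group_comm_groupI)
  have gen: "generate G (carrier G \<inter> {a, b}) \<subseteq> rotations"
  proof
    fix h assume "h \<in> generate G (carrier G \<inter> {a, b})"
    then show "h \<in> rotations"
    proof induction
      case one
      show ?case unfolding rotations_def by (metis int_pow_0 rangeI)
    next
      case (incl h)
      then show ?case using assms by auto
    next
      case (inv h)
      then have "h \<in> rotations" using assms by auto
      then show ?case by (auto simp: rotations_def inv_rotation)
    next
      case (eng h1 h2)
      then show ?case by (auto simp: rotations_def rotation_rotation)
    qed
  qed
  fix g h
  assume "g \<in> carrier (subgroup_generated G {a, b})" "h \<in> carrier (subgroup_generated G {a, b})"
  then have "g \<in> rotations" "h \<in> rotations"
    using gen by (auto simp: carrier_subgroup_generated)
  then show "g \<otimes>\<^bsub>subgroup_generated G {a, b}\<^esub> h = h \<otimes>\<^bsub>subgroup_generated G {a, b}\<^esub> g"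
    by (auto simp: rotations_def rotation_rotation add.commute)
qed simp

lemma rotation_classes_adjacent:
  assumes "A \<in> noncentral_classes G" "B \<in> noncentral_classes G" "A \<noteq> B"
    "A \<subseteq> rotations" "B \<subseteq> rotations"
  shows "(A, B) \<in> parcs (ccc_graph G)"
proof -
  obtain a b where "a \<in> A" "b \<in> B" using noncentral_class_nonempty assms(1,2) by blast
  moreover from this have "comm_group (subgroup_generated G {a, b})"
    using assms(4,5) by (intro comm_group_rotations) auto
  ultimately show ?thesis using assms(1-3) by (auto simp: ccc_graph_def)
qed

text \<open>
  No edge leaves the clique of rotation classes: an element commuting with a non-central rotation
  cannot be a reflection, by \<open>rotation_central\<close>.
\<close>

lemma adjacent_rotation_classes:
  assumes "(A, B) \<in> parcs (ccc_graph G)"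
  shows "A \<subseteq> rotations \<longleftrightarrow> B \<subseteq> rotations"
proof -
  obtain a b where AB: "A \<in> noncentral_classes G" "B \<in> noncentral_classes G"
    and ab: "a \<in> A" "b \<in> B" "a \<otimes> b = b \<otimes> a"
    using assms by (rule ccc_graph_adjacentE) blast
  have step: "D \<subseteq> rotations"
    if C: "C \<in> noncentral_classes G" "c \<in> C" "C \<subseteq> rotations"
      and D: "D \<in> noncentral_classes G" "d \<in> D" and comm: "c \<otimes> d = d \<otimes> c" for C D c d
  proof -
    obtain i :: int where c: "c = x [^] i" using C by (auto simp: rotations_def)
    from D show ?thesis
    proof (cases rule: noncentral_element_cases)
      case (rotation j)
      then show ?thesis using rotation_class_subset[OF D] by (auto simp: rotations_def)
    next
      case (reflection j)
      then have "c \<in> group_center G" using comm rotation_central by (simp add: c)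
      then show ?thesis using noncentral_classE(2)[OF C(1,2)] by contradiction
    qed
  qed
  show ?thesis using step[OF AB(1) ab(1) _ AB(2) ab(2,3)]
      step[OF AB(2) ab(2) _ AB(1) ab(1) ab(3)[symmetric]] by blast
qed

lemma nonrotation_class_representative:
  assumes A: "A \<in> noncentral_classes G" "\<not> A \<subseteq> rotations" and a: "a \<in> A"
  obtains i :: int where "a = x [^] i \<otimes> y" "A = conj_class G (x [^] (i mod 2) \<otimes> y)"
  using A(1) a
proof (cases rule: noncentral_element_cases)
  case (rotation i)
  then show ?thesis using rotation_class_subset[OF A(1) a] A(2) by (auto simp: rotations_def)
next
  case (reflection i)
  then show ?thesis
    using that noncentral_classE(3)[OF A(1) a] reflection_conj_class_parity by metis
qed

lemma nonrotation_classes: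
  assumes "A \<in> noncentral_classes G" "\<not> A \<subseteq> rotations"
  shows "A = conj_class G y \<or> A = conj_class G (x \<otimes> y)"
proof -
  obtain a where "a \<in> A" using noncentral_class_nonempty assms(1) by blast
  with assms obtain i :: int where A: "A = conj_class G (x [^] (i mod 2) \<otimes> y)"
    by (rule nonrotation_class_representative)
  have "i mod 2 = 0 \<or> i mod 2 = 1" by auto
  then show ?thesis using A by (elim disjE) simp_all
qed

text \<open>
  The neighbours of a rotation class are rotation classes, which are pairwise adjacent. Outside
  the rotations there are at most two classes, too few for a path on three vertices.
\<close>

lemma ccc_graph_cluster: "cluster_graph (ccc_graph G)"
  unfolding cluster_graph_def
proof (intro allI impI)
  fix A B C
  assume AB: "(A, B) \<in> parcs (ccc_graph G)" and BC: "(B, C) \<in> parcs (ccc_graph G)"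
    and "A \<noteq> C"
  have vs: "A \<in> noncentral_classes G" "B \<in> noncentral_classes G" "C \<in> noncentral_classes G"
    "A \<noteq> B" "B \<noteq> C"
    using AB BC by (auto simp: ccc_graph_def)
  show "(A, C) \<in> parcs (ccc_graph G)"
  proof (cases "B \<subseteq> rotations")
    case True
    then show ?thesis
      using rotation_classes_adjacent adjacent_rotation_classes AB BC vs \<open>A \<noteq> C\<close> by blast
  next
    case False
    then have "\<not> A \<subseteq> rotations" "\<not> C \<subseteq> rotations"
      using adjacent_rotation_classes AB BC by blast+
    then show ?thesis using nonrotation_classes vs \<open>A \<noteq> C\<close> False by metis
  qed
qed

text \<open>
  Suppose that two distinct classes of reflections contain commuting members \<open>x\<^sup>i y\<close> and
  \<open>x\<^sup>j y\<close>. Distinctness makes \<open>i - j\<close> odd, while commuting makes the order of \<open>x\<close> divide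
  \<open>2(i - j)\<close>, which is \<open>2\<close> modulo \<open>4\<close>. The only order left is odd, and then \<open>x\<^sup>i\<close> may be rewritten
  with an exponent of the other parity, which merges the two classes.
\<close>

lemma adjacent_classes_rotations:
  assumes ord: "ord x mod 4 \<noteq> 2" and AB: "(A, B) \<in> parcs (ccc_graph G)"
  shows "A \<subseteq> rotations"
proof (rule ccontr)
  assume A: "\<not> A \<subseteq> rotations"
  then have B: "\<not> B \<subseteq> rotations" using adjacent_rotation_classes AB by blast
  obtain a b where vs: "A \<in> noncentral_classes G" "B \<in> noncentral_classes G" "A \<noteq> B"
    and ab: "a \<in> A" "b \<in> B" "a \<otimes> b = b \<otimes> a"
    using AB by (rule ccc_graph_adjacentE)
  obtain i :: int where i: "a = x [^] i \<otimes> y" "A = conj_class G (x [^] (i mod 2) \<otimes> y)"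
    using vs(1) A ab(1) by (rule nonrotation_class_representative)
  obtain j :: int where j: "b = x [^] j \<otimes> y" "B = conj_class G (x [^] (j mod 2) \<otimes> y)"
    using vs(2) B ab(2) by (rule nonrotation_class_representative)
  \<comment> \<open>The second factor cancels \<open>M\<close> and moves both exponents to one side.\<close>
  have "x [^] (i - j + M) \<otimes> x [^] (i - j - M) = x [^] (j - i + M) \<otimes> x [^] (i - j - M)"
    using ab(3) by (simp add: i(1) j(1) normal_form_mult)
  then have "x [^] (2 * (i - j)) = \<one>"
    unfolding rotation_rotation by (simp add: algebra_simps)
  then have dvd: "int (ord x) dvd 2 * (i - j)"
    using int_pow_eq_id[OF x_closed] by blast
  have "i mod 2 \<noteq> j mod 2" using vs(3) i(2) j(2) by auto
  then have odd: "odd (i - j)" by presburger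
  have "odd (ord x)"
  proof
    assume "even (ord x)"
    then have "4 dvd int (ord x)" using ord by presburger
    then have "4 dvd 2 * (i - j)" using dvd by (rule dvd_trans)
    with odd show False by presburger
  qed
  \<comment> \<open>Adding the odd order to \<open>i\<close> changes its parity but not the reflection.\<close>
  have "x [^] int (ord x) = \<one>"
    using int_pow_eq_id[OF x_closed, of "int (ord x)"] by simp
  then have "x [^] i \<otimes> y = x [^] (i + int (ord x)) \<otimes> y"
    by (simp flip: rotation_rotation)
  then have "A = conj_class G (x [^] ((i + int (ord x)) mod 2) \<otimes> y)"
    using i(2) by (metis reflection_conj_class_parity)
  moreover have "(i + int (ord x)) mod 2 = j mod 2"
    using \<open>odd (ord x)\<close> odd by presburger
  ultimately show False using j(2) vs(3) by simp
qed

lemma ccc_graph_no_two_K2: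
  assumes "ord x mod 4 \<noteq> 2"
  shows "\<not> has_induced two_K2 (ccc_graph G)"
proof (rule two_K2_not_induced)
  fix A B C D
  assume edges: "(A, B) \<in> parcs (ccc_graph G)" "(C, D) \<in> parcs (ccc_graph G)" and "A \<noteq> C"
  moreover from edges have "A \<in> noncentral_classes G" "C \<in> noncentral_classes G"
    by (auto simp: ccc_graph_def)
  ultimately show "(A, C) \<in> parcs (ccc_graph G)"
    using rotation_classes_adjacent adjacent_classes_rotations[OF assms] by blast
qed

theorem ccc_graph_properties:
  "cograph (ccc_graph G) \<and> chordal_graph (ccc_graph G) \<and>
    (ord x mod 4 \<noteq> 2 \<longrightarrow> split_graph (ccc_graph G) \<and> threshold_graph (ccc_graph G))"
  using cluster_graph_cograph cluster_graph_chordal cluster_graph_split_threshold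
    ccc_graph_cluster ccc_graph_no_two_K2 by blast

end


section \<open>Evaluation of words in a presented group\<close>

text \<open>
  Evaluating words through the isomorphism lets all computations take place in \<open>G\<close>, so that
  nothing about conjugacy classes has to be transported along it.
\<close>

lemma (in group) presented_group_evaluation:
  assumes "G \<cong> presented_group R"
  shows "\<exists>ev. (\<forall>u v. ev (u @ v) = ev u \<otimes> ev v) \<and> carrier G = range ev \<and>
    (\<forall>u v. ev u = ev v \<longleftrightarrow> word_eq R u v)"
proof -
  obtain h where h: "h \<in> iso (presented_group R) G"
    using iso_sym[OF assms] by (auto simp: is_iso_def)
  define ev where "ev = h \<circ> word_class R"
  have cl: "word_class R u \<in> carrier (presented_group R)" for u
    by (simp add: presented_group_def)
  have "ev (u @ v) = ev u \<otimes> ev v" for u v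
    using h cl by (auto simp: ev_def iso_def hom_mult simp flip: presented_group_mult)
  moreover have "carrier G = range ev"
    using h by (auto simp: ev_def iso_def bij_betw_def presented_group_def image_comp)
  moreover have "ev u = ev v \<longleftrightarrow> word_eq R u v" for u v
    using h cl inj_on_eq_iff[of h "carrier (presented_group R)"]
    by (auto simp: ev_def iso_def bij_betw_def word_class_eq_iff)
  ultimately show ?thesis by blast
qed

text \<open>
  The pair \<open>(k, e)\<close> stands for the normal form \<open>x\<^sup>k y\<^sup>e\<close>, and a letter acts by left multiplication
  under the rules \<open>y x\<^sup>k = x\<^bsup>-k\<^esup> y\<close> and \<open>y\<^sup>2 = x\<^sup>M\<close>. The rule for \<open>y\<inverse>\<close> is chosen as the inverse map
  on the integers, before exponents are reduced, so that cancellation of letters holds exactly.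
\<close>

fun letter_act :: "int \<Rightarrow> xy \<times> bool \<Rightarrow> int \<times> bool \<Rightarrow> int \<times> bool" where
  "letter_act M (X, b) (k, e) = (if b then k + 1 else k - 1, e)"
| "letter_act M (Y, b) (k, e) = (if b = e then M - k else - k, \<not> e)"

definition word_act :: "int \<Rightarrow> xy word \<Rightarrow> int \<times> bool \<Rightarrow> int \<times> bool" where
  "word_act M u = foldr (letter_act M) u"

definition normal_form_eq :: "nat \<Rightarrow> int \<times> bool \<Rightarrow> int \<times> bool \<Rightarrow> bool" where
  "normal_form_eq N p q \<longleftrightarrow> [fst p = fst q] (mod int N) \<and> snd p = snd q"

lemma normal_form_eq_trans:
  "normal_form_eq N p q \<Longrightarrow> normal_form_eq N q r \<Longrightarrow> normal_form_eq N p r"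
  unfolding normal_form_eq_def using cong_trans by metis

lemma word_act_append: "word_act M (u @ v) p = word_act M u (word_act M v p)"
  by (simp add: word_act_def)

lemma word_act_cong:
  "normal_form_eq N p q \<Longrightarrow> normal_form_eq N (word_act M u p) (word_act M u q)"
proof (induction u)
  case (Cons a u)
  have step: "normal_form_eq N (letter_act M a p) (letter_act M a q)"
    if "normal_form_eq N p q" for p q
    using that
    by (cases a; cases "fst a"; cases p; cases q)
       (auto simp: normal_form_eq_def intro: cong_add cong_diff cong_minus_minus_iff[THEN iffD2])
  show ?case using Cons step by (simp add: word_act_def)
qed (simp add: word_act_def)

text \<open>
  It suffices to check the defining relations: congruence of normal forms is an equivalence
  relation preserved by every word, and mutually inverse letters act as mutually inverse maps.
\<close>

lemma word_act_respects_word_eq: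
  assumes R: "\<And>u v p. (u, v) \<in> R \<Longrightarrow> normal_form_eq N (word_act M u p) (word_act M v p)"
    and "word_eq R u v"
  shows "normal_form_eq N (word_act M u p) (word_act M v p)"
  using assms(2)
proof (induction arbitrary: p)
  case (refl u)
  show ?case by (simp add: normal_form_eq_def)
next
  case (sym u v)
  show ?case using sym.IH[of p] by (simp add: normal_form_eq_def cong_sym)
next
  case (trans u v w)
  show ?case using trans.IH[of p] by (rule normal_form_eq_trans)
next
  case (append u u' v v')
  have "normal_form_eq N (word_act M u (word_act M v p)) (word_act M u (word_act M v' p))"
    using append.IH(2) by (rule word_act_cong)
  then show ?case
    using append.IH(1)[of "word_act M v' p"] unfolding word_act_append
    by (rule normal_form_eq_trans)
next
  case (cancel g b)
  show ?case by (cases g; cases p) (auto simp: word_act_def normal_form_eq_def)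
next
  case (rel u v)
  then show ?case by (rule R)
qed

lemma word_pow_Suc: "word_pow w (Suc n) = w @ word_pow w n"
  by (simp add: word_pow_def)

lemma word_act_pow_X: "word_act M (word_pow (word_gen X) n) (k, e) = (k + int n, e)"
  by (induction n)
     (simp_all add: word_pow_Suc word_act_append,
      simp_all add: word_pow_def word_gen_def word_act_def)

text \<open>
  The condition \<open>act\<close> gives the lower bound on the order of \<open>x\<close>: the word \<open>x\<^sup>k\<close> takes the normal
  form \<open>(0, False)\<close> to \<open>(k, False)\<close>, so it can be trivial only if \<open>N\<close> divides \<open>k\<close>.
\<close>

lemma inverting_pair_from_presentation:
  fixes G (structure)
  assumes "group G" and iso: "G \<cong> presented_group R"
    and inverts: "word_eq R (word_gen Y @ word_gen X) (word_inv_gen X @ word_gen Y)"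
    and square: "word_eq R (word_pow (word_gen Y) 2) (word_pow (word_gen X) m)"
    and order: "word_eq R (word_pow (word_gen X) N) []"
    and act: "\<And>u v p. (u, v) \<in> R \<Longrightarrow>
      normal_form_eq N (word_act (int m) u p) (word_act (int m) v p)"
  obtains x y where "inverting_pair G x y (int m)" "group.ord G x = N"
proof -
  interpret group G by fact
  obtain ev where ev_append: "\<And>u v. ev (u @ v) = ev u \<otimes> ev v" and ran: "carrier G = range ev"
    and ev_eq: "\<And>u v. ev u = ev v \<longleftrightarrow> word_eq R u v"
    using presented_group_evaluation[OF iso] by blast
  define x where "x = ev (word_gen X)"
  define y where "y = ev (word_gen Y)"
  have closed: "ev u \<in> carrier G" for u using ran by auto
  have ev_Nil: "ev [] = \<one>"
    using ev_append[of "[]" "[]"] closed[of "[]"] by (metis append_Nil l_cancel_one)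
  have ev_inv: "ev [(g, False)] = inv (ev [(g, True)])" for g
  proof (rule inv_equality[symmetric])
    have "word_eq R ([(g, False)] @ [(g, True)]) []"
      using word_eq.cancel[of R g False] by simp
    then show "ev [(g, False)] \<otimes> ev [(g, True)] = \<one>"
      using ev_eq ev_append ev_Nil by metis
  qed (rule closed)+
  have ev_pow: "ev (word_pow w k) = ev w [^] k" for w and k :: nat
  proof (induction k)
    case 0
    show ?case by (simp add: word_pow_def ev_Nil)
  next
    case (Suc k)
    then show ?case unfolding word_pow_Suc ev_append using nat_pow_Suc2[OF closed] by metis
  qed
  have ev_generate: "ev u \<in> generate G {x, y}" for u
  proof (induction u)
    case (Cons l u)
    obtain g b where l: "l = (g, b)" by (cases l)
    have "ev [(g, True)] \<in> {x, y}" by (cases g) (auto simp: x_def y_def word_gen_def)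
    then have "ev [l] \<in> generate G {x, y}"
      by (cases b) (auto simp: l ev_inv intro: generate.incl generate.inv)
    then show ?case using ev_append[of "[l]" u] Cons by (auto intro: generate.eng)
  qed (simp add: ev_Nil generate.one)
  have pair: "inverting_pair G x y (int m)"
  proof
    show xy: "x \<in> carrier G" "y \<in> carrier G" by (simp_all add: x_def y_def closed)
    show "y \<otimes> x = inv x \<otimes> y"
      using inverts ev_inv by (simp add: x_def y_def word_gen_def word_inv_gen_def
          flip: ev_eq ev_append) (metis ev_append append_Cons append_Nil)
    show "y \<otimes> y = x [^] int m"
      using square xy by (simp add: ev_pow numeral_2_eq_2 int_pow_int flip: ev_eq x_def y_def)
    show "carrier G = generate G {x, y}"
    proof
      show "carrier G \<subseteq> generate G {x, y}" unfolding ran using ev_generate by auto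
      show "generate G {x, y} \<subseteq> carrier G" using xy by (intro generate_incl) simp
    qed
  qed
  have x: "x \<in> carrier G" by (simp add: x_def closed)
  have "x [^] N = \<one>" using order by (simp add: ev_pow ev_Nil flip: ev_eq x_def)
  moreover have "N dvd k" if "x [^] k = \<one>" for k :: nat
  proof -
    have "word_eq R (word_pow (word_gen X) k) []"
      using that by (simp add: ev_pow ev_Nil flip: ev_eq x_def)
    then have "normal_form_eq N (word_act (int m) (word_pow (word_gen X) k) (0, False))
        (word_act (int m) [] (0, False))"
      using act by (rule word_act_respects_word_eq[rotated])
    then show ?thesis
      by (simp add: word_act_pow_X normal_form_eq_def cong_0_iff)
         (simp add: word_act_def cong_0_iff)
  qed
  ultimately have "ord x = N" using x pow_eq_id pow_ord_eq_1 by (metis dvd_antisym)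
  with pair that show thesis by blast
qed

text \<open>
  The two presentations state the inversion of \<open>x\<close> as \<open>y x y\<inverse> = x\<inverse>\<close> and as \<open>y\<inverse> x y = x\<inverse>\<close>.
  Moving letters across an equation brings both into the form \<open>y x = x\<inverse> y\<close>.
\<close>

lemma word_eq_shift_right:
  assumes "word_eq R (u @ [(g, b)]) v"
  shows "word_eq R u (v @ [(g, \<not> b)])"
proof -
  have "word_eq R u (u @ [(g, b), (g, \<not> b)])"
    using word_eq.append[OF word_eq.refl[of R u] word_eq.sym[OF word_eq.cancel[of R g b]]] by simp
  moreover have "word_eq R (u @ [(g, b), (g, \<not> b)]) (v @ [(g, \<not> b)])"
    using word_eq.append[OF assms word_eq.refl[of R "[(g, \<not> b)]"]] by simp
  ultimately show ?thesis by (rule word_eq.trans)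
qed

lemma word_eq_shift_left:
  assumes "word_eq R ((g, b) # u) v"
  shows "word_eq R u ((g, \<not> b) # v)"
proof -
  have "word_eq R u ((g, \<not> b) # (g, b) # u)"
    using word_eq.append[OF word_eq.sym[OF word_eq.cancel[of R g "\<not> b"]] word_eq.refl[of R u]]
    by simp
  moreover have "word_eq R ((g, \<not> b) # (g, b) # u) ((g, \<not> b) # v)"
    using word_eq.append[OF word_eq.refl[of R "[(g, \<not> b)]"] assms] by simp
  ultimately show ?thesis by (rule word_eq.trans)
qed

lemma dihedral_inverting_pair:
  fixes G (structure)
  assumes "group G" "G \<cong> dihedral_group n"
  obtains x y where "inverting_pair G x y 0" "group.ord G x = n"
proof -
  define R where "R = {(word_pow (word_gen X) n, []),
     (word_pow (word_gen Y) 2, []),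
     (word_gen Y @ word_gen X @ word_inv_gen Y, word_inv_gen X)}"
  have iso: "G \<cong> presented_group R" using assms by (simp add: dihedral_group_def R_def)
  have "word_eq R ([(Y, True), (X, True)] @ [(Y, False)]) [(X, False)]"
    by (rule word_eq.rel) (simp add: R_def word_gen_def word_inv_gen_def)
  from word_eq_shift_right[OF this]
  have inverts: "word_eq R (word_gen Y @ word_gen X) (word_inv_gen X @ word_gen Y)"
    by (simp add: word_gen_def word_inv_gen_def)
  have square: "word_eq R (word_pow (word_gen Y) 2) (word_pow (word_gen X) 0)"
    by (rule word_eq.rel) (simp add: R_def word_pow_def)
  have order: "word_eq R (word_pow (word_gen X) n) []"
    by (rule word_eq.rel) (simp add: R_def)
  have act: "normal_form_eq n (word_act (int 0) u p) (word_act (int 0) v p)"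
    if "(u, v) \<in> R" for u v p
    using that
    by (cases p; cases "snd p")
       (auto simp: R_def word_act_pow_X, auto simp: normal_form_eq_def word_act_def
          word_pow_def numeral_2_eq_2 word_gen_def word_inv_gen_def cong_def)
  show thesis
  proof (rule inverting_pair_from_presentation[OF assms(1) iso inverts square order])
    fix x y
    assume "inverting_pair G x y (int 0)" "group.ord G x = n"
    then show thesis using that by simp
  qed (rule act)
qed

lemma dicyclic_inverting_pair:
  fixes G (structure)
  assumes "group G" "G \<cong> dicyclic_group n"
  obtains x y where "inverting_pair G x y (int n)" "group.ord G x = 2 * n"
proof -
  define R where "R = {(word_pow (word_gen X) (2 * n), []),
     (word_pow (word_gen X) n, word_pow (word_gen Y) 2),
     (word_inv_gen Y @ word_gen X @ word_gen Y, word_inv_gen X)}"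
  have iso: "G \<cong> presented_group R" using assms by (simp add: dicyclic_group_def R_def)
  have "word_eq R ((Y, False) # [(X, True), (Y, True)]) [(X, False)]"
    by (rule word_eq.rel) (simp add: R_def word_gen_def word_inv_gen_def)
  from word_eq_shift_left[OF word_eq_shift_left[OF this]]
  have "word_eq R ([(X, False), (Y, True)] @ [(X, False)]) [(Y, True)]"
    by (simp add: word_eq.sym)
  from word_eq.sym[OF word_eq_shift_right[OF this]]
  have inverts: "word_eq R (word_gen Y @ word_gen X) (word_inv_gen X @ word_gen Y)"
    by (simp add: word_gen_def word_inv_gen_def)
  have square: "word_eq R (word_pow (word_gen Y) 2) (word_pow (word_gen X) n)"
    by (rule word_eq.sym, rule word_eq.rel) (simp add: R_def)
  have order: "word_eq R (word_pow (word_gen X) (2 * n)) []"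
    by (rule word_eq.rel) (simp add: R_def)
  \<comment> \<open>On \<open>x\<^sup>k y\<close> the word \<open>x\<^sup>n\<close> adds \<open>n\<close> to the exponent, whereas \<open>y\<^sup>2\<close> subtracts it; this is
    the same modulo \<open>2n\<close>.\<close>
  have shift: "[k + int n = k - int n] (mod int (2 * n))" for k
    by (simp add: cong_iff_dvd_diff)
  have act: "normal_form_eq (2 * n) (word_act (int n) u p) (word_act (int n) v p)"
    if "(u, v) \<in> R" for u v p
    using that shift[of "fst p"]
    by (cases p; cases "snd p")
       (auto simp: R_def word_act_pow_X, auto simp: normal_form_eq_def word_act_def
          word_pow_def numeral_2_eq_2 word_gen_def word_inv_gen_def cong_def algebra_simps)
  show thesis
  proof (rule inverting_pair_from_presentation[OF assms(1) iso inverts square order])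
    fix x y
    assume "inverting_pair G x y (int n)" "group.ord G x = 2 * n"
    then show thesis using that by simp
  qed (rule act)
qed

theorem theorem5p1:
  fixes G :: "('a, 'b) monoid_scheme" and n :: nat
  assumes "group G" and "n > 0"
  shows "(G \<cong> dihedral_group n \<longrightarrow>
            cograph (ccc_graph G) \<and> chordal_graph (ccc_graph G) \<and>
            (\<not> [n = 2] (mod 4) \<longrightarrow> split_graph (ccc_graph G) \<and> threshold_graph (ccc_graph G)))
       \<and> (G \<cong> dicyclic_group n \<longrightarrow>
            cograph (ccc_graph G) \<and> chordal_graph (ccc_graph G) \<and>
            (even n \<longrightarrow> split_graph (ccc_graph G) \<and> threshold_graph (ccc_graph G)))"
proof (intro conjI impI)
  assume "G \<cong> dihedral_group n"
  then obtain x y where "inverting_pair G x y 0" "group.ord G x = n"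
    using dihedral_inverting_pair[OF assms(1)] by blast
  note props = inverting_pair.ccc_graph_properties[OF this(1), unfolded this(2)]
  show "cograph (ccc_graph G)" "chordal_graph (ccc_graph G)" using props by blast+
  assume "\<not> [n = 2] (mod 4)"
  then have "n mod 4 \<noteq> 2" by (simp add: cong_def)
  then show "split_graph (ccc_graph G)" "threshold_graph (ccc_graph G)" using props by blast+
next
  assume "G \<cong> dicyclic_group n"
  then obtain x y where "inverting_pair G x y (int n)" "group.ord G x = 2 * n"
    using dicyclic_inverting_pair[OF assms(1)] by blast
  note props = inverting_pair.ccc_graph_properties[OF this(1), unfolded this(2)]
  show "cograph (ccc_graph G)" "chordal_graph (ccc_graph G)" using props by blast+
  assume "even n"
  then have "2 * n mod 4 \<noteq> 2" by presburger
  then show "split_graph (ccc_graph G)" "threshold_graph (ccc_graph G)" using props by blast+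
qed

end
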